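(* Let $k\neq h$ be positive integers with $\gcd(k,h)=1$ and let $n\ne 2$ be a positive integer. Then $$\mathcal{Z}(n,k,h)=\begin{cases}\Phi_n(k,h) & \text{if } n\neq p^zP_p(k,h) \text{ for every prime } p \text{ and every positive integer } z,\\[4pt] \dfrac{\Phi_n(k,h)}{p} & \text{if } n=p^zP_p(k,h) \text{ for some prime } p \text{ and some positive integer } z.\end{cases}$$
   Context: For positive integers $k,h,N$, the primitive index $P_N(k,h)$ is the least positive integer $u$ such that $N\mid k^u-h^u$ (if such a $u$ exists). A primitive prime divisor of the term $k^n-h^n$ is a prime $p$ dividing it with $P_p(k,h)=n$. The Zsigmondy number $\mathcal{Z}(n,k,h)$ is the product of the primitive prime divisors of $k^n-h^n$, counted with the multiplicity with which they divide $k^n-h^n$ (empty product $=1$). The homogenized cyclotomic polynomial values are defined recursively by $\Phi_n(k,h)=\dfrac{k^n-h^n}{\prod_{d\mid n,\,d<n}\Phi_d(k,h)}$.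
   Formalization: For n = 1 and k < h the printed formula fails by a sign (k=1, h=2: Z = 1 but Φ_1 = −1); in exactly that case the formal statement gives Z(1,k,h) = −Φ_1(k,h). *)

theory Defs
  imports Complex_Main "HOL-Computational_Algebra.Primes"
begin

text \<open>The primitive index \<open>P\<^sub>N(k,h)\<close>. The value 0 encodes that it does not exist, so that for
  \<open>n > 0\<close> an equation \<open>n = p ^ z * primitive_index p k h\<close> entails its existence.\<close>

definition primitive_index :: "nat \<Rightarrow> nat \<Rightarrow> nat \<Rightarrow> nat" where
  "primitive_index N k h =
     (if \<exists>u>0. int N dvd int k ^ u - int h ^ u
      then LEAST u. u > 0 \<and> int N dvd int k ^ u - int h ^ u
      else 0)"

definition primitive_prime_divisor :: "nat \<Rightarrow> nat \<Rightarrow> nat \<Rightarrow> nat \<Rightarrow> bool" where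
  "primitive_prime_divisor p n k h \<longleftrightarrow>
     prime p \<and> int p dvd int k ^ n - int h ^ n \<and> primitive_index p k h = n"

definition zsigmondy_number :: "nat \<Rightarrow> nat \<Rightarrow> nat \<Rightarrow> nat" where
  "zsigmondy_number n k h =
     (\<Prod>p | primitive_prime_divisor p n k h. p ^ multiplicity (int p) (int k ^ n - int h ^ n))"

text \<open>The quotient is taken in the rationals, so that no integrality is presupposed. For
  \<open>k < h\<close> the value at \<open>n = 1\<close> is the negative number \<open>k - h\<close>.\<close>

fun hom_cyclotomic :: "nat \<Rightarrow> nat \<Rightarrow> nat \<Rightarrow> rat" where
  "hom_cyclotomic n k h =
     (of_nat k ^ n - of_nat h ^ n) / (\<Prod>d\<in>{d. d dvd n \<and> d < n}. hom_cyclotomic d k h)"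

declare hom_cyclotomic.simps [simp del]

end

theory Submission
  imports Defs "HOL-Number_Theory.Residues"
begin

text \<open>Fix a prime \<open>p\<close> of index \<open>u\<close> and let \<open>v\<close> be the \<open>p\<close>-adic valuation of
  \<open>k ^ n - h ^ n\<close> as a function of \<open>n\<close>. It vanishes unless \<open>u\<close> divides \<open>n\<close>, and it does not change
  when such an \<open>n\<close> is multiplied by a number prime to \<open>p\<close>. Hence its Moebius inverse, which is the
  valuation of the cyclotomic value, is supported on the numbers \<open>u * p ^ z\<close>: it is \<open>v u\<close> at \<open>u\<close>,
  and for \<open>z > 0\<close> it is the increment of \<open>v\<close> from \<open>n div p\<close> to \<open>n\<close>, which is 1 by lifting the
  exponent unless \<open>n = 2\<close>. The first case gives the Zsigmondy number; the second occurs for at most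
  one \<open>p\<close>, since \<open>u\<close> divides \<open>p - 1\<close> by Fermat and so \<open>p\<close> is the largest prime factor of \<open>n\<close>.\<close>

section \<open>Lifting the exponent for differences of integer powers\<close>

lemma power_diff_eq_sum:
  fixes x y :: "'a::comm_ring_1"
  shows "x ^ n - y ^ n = (x - y) * (\<Sum>i<n. x ^ i * y ^ (n - 1 - i))"
  using diff_power_eq_sum[of x "n - 1" y] by (cases n) auto

text \<open>Modulo \<open>p\<close>, \<open>x\<close> may be replaced by \<open>y\<close>, so all
  \<open>n\<close> summands become \<open>y ^ (n - 1)\<close>. This controls the cofactor of
  \<open>x - y\<close> in \<open>x ^ n - y ^ n\<close>.\<close>

lemma cong_sum_power_products:
  fixes x y p :: int
  assumes "p dvd x - y"
  shows "[(\<Sum>i<n. x ^ i * y ^ (n - 1 - i)) = int n * y ^ (n - 1)] (mod p)"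
proof -
  have xy: "[x = y] (mod p)"
    using assms by (simp add: cong_iff_dvd_diff)
  have "[(\<Sum>i<n. x ^ i * y ^ (n - 1 - i)) = (\<Sum>i<n. y ^ i * y ^ (n - 1 - i))] (mod p)"
    by (intro cong_sum cong_mult cong_pow xy cong_refl)
  also have "(\<Sum>i<n. y ^ i * y ^ (n - 1 - i)) = (\<Sum>i<n. y ^ (n - 1))"
    by (intro sum.cong refl) (simp flip: power_add)
  finally show ?thesis by simp
qed

lemma multiplicity_power_diff_coprime:
  fixes x y p :: int
  assumes p: "prime p" and xy: "p dvd x - y" and y: "\<not> p dvd y" and n: "\<not> p dvd int n"
  shows "multiplicity p (x ^ n - y ^ n) = multiplicity p (x - y)"
proof -
  let ?S = "\<Sum>i<n. x ^ i * y ^ (n - 1 - i)"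
  have "\<not> p dvd int n * y ^ (n - 1)"
    using p y n by (auto simp: prime_dvd_mult_iff dest: prime_dvd_power)
  then have "\<not> p dvd ?S"
    using cong_sum_power_products[OF xy, of n] cong_dvd_iff by blast
  then show ?thesis
    unfolding power_diff_eq_sum[of x n y] mult.commute[of "x - y"]
    by (rule multiplicity_prime_elem_times_other[OF prime_imp_prime_elem[OF p]])
qed

lemma multiplicity_times_exact:
  fixes d S p :: int
  assumes p: "prime p" and "d \<noteq> 0" and "p dvd S" and "\<not> p ^ 2 dvd S"
  shows "multiplicity p (d * S) = Suc (multiplicity p d)"
proof -
  have "multiplicity p S = 1"
    using assms by (intro multiplicity_eqI) (auto simp: numeral_2_eq_2)
  moreover have "S \<noteq> 0"
    using assms by auto
  ultimately show ?thesis
    using \<open>d \<noteq> 0\<close>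
    by (simp add: prime_elem_multiplicity_mult_distrib[OF prime_imp_prime_elem[OF p]])
qed

text \<open>The cofactor \<open>?S p\<close> is divisible by \<open>p\<close> exactly once because
  it is congruent to \<open>p * y ^ (p - 1)\<close> modulo the square of \<open>p\<close>. The error
  is \<open>x - y\<close> times a sum that modulo \<open>p\<close> is \<open>y ^ (p - 2)\<close>
  times \<open>0 + ... + (p - 1)\<close>; the latter is a multiple of \<open>p\<close> since
  \<open>p\<close> is odd.\<close>

lemma multiplicity_power_diff_odd_prime:
  fixes x y :: int
  assumes p: "prime p" and odd: "p \<noteq> (2::nat)" and xy: "int p dvd x - y"
    and y: "\<not> int p dvd y" and neq: "x \<noteq> y"
  shows "multiplicity (int p) (x ^ p - y ^ p) = Suc (multiplicity (int p) (x - y))"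
proof -
  let ?S = "\<lambda>m. \<Sum>i<m. x ^ i * y ^ (m - 1 - i)"
  have p3: "p > 2" and op: "odd p"
    using p odd prime_ge_2_nat[of p] prime_odd_nat[of p] by auto
  have dvd: "int p dvd ?S p"
    using cong_sum_power_products[OF xy, of p] cong_dvd_iff by fastforce
  have "?S p - int p * y ^ (p - 1) = (\<Sum>i<p. x ^ i * y ^ (p - 1 - i)) - (\<Sum>i<p. y ^ (p - 1))"
    by simp
  also have "\<dots> = (\<Sum>i<p. (x ^ i - y ^ i) * y ^ (p - 1 - i))"
    unfolding sum_subtractf[symmetric]
    by (intro sum.cong refl) (simp add: left_diff_distrib flip: power_add)
  also have "\<dots> = (x - y) * (\<Sum>i<p. ?S i * y ^ (p - 1 - i))"
    unfolding sum_distrib_left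
    by (intro sum.cong refl) (subst power_diff_eq_sum, simp add: mult.assoc)
  finally have eq: "?S p - int p * y ^ (p - 1) = (x - y) * (\<Sum>i<p. ?S i * y ^ (p - 1 - i))" .
  have "[(\<Sum>i<p. ?S i * y ^ (p - 1 - i)) = (\<Sum>i<p. int i * y ^ (i - 1) * y ^ (p - 1 - i))] (mod int p)"
    by (intro cong_sum cong_mult cong_sum_power_products xy cong_refl)
  also have "(\<Sum>i<p. int i * y ^ (i - 1) * y ^ (p - 1 - i)) = (\<Sum>i<p. int i) * y ^ (p - 2)"
    unfolding sum_distrib_right
  proof (intro sum.cong refl)
    fix i assume "i \<in> {..<p}"
    then show "int i * y ^ (i - 1) * y ^ (p - 1 - i) = int i * y ^ (p - 2)"
      by (cases i) (auto simp: mult.assoc numeral_2_eq_2 simp flip: power_add)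
  qed
  also have "(\<Sum>i<p. int i) = int p * int ((p - 1) div 2)"
  proof -
    obtain m where m: "p = 2 * m + 1"
      using op by (elim oddE)
    have "(\<Sum>i<2 * m + 1. int i) = (2 * int m + 1) * int m"
      by (induction m) (auto simp: algebra_simps)
    then show ?thesis
      using m by simp
  qed
  finally have "int p dvd (\<Sum>i<p. ?S i * y ^ (p - 1 - i))"
    using cong_dvd_iff by fastforce
  then have sq: "(int p)\<^sup>2 dvd ?S p - int p * y ^ (p - 1)"
    unfolding eq power2_eq_square using xy by (intro mult_dvd_mono)
  have "\<not> (int p)\<^sup>2 dvd int p * y ^ (p - 1)"
    using p y prime_dvd_power[of "int p" y] by (auto simp: power2_eq_square)
  then have "\<not> (int p)\<^sup>2 dvd ?S p"
    using dvd_diff[OF _ sq, of "?S p"] by auto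
  then show ?thesis
    using p neq dvd by (subst power_diff_eq_sum) (simp add: multiplicity_times_exact)
qed

text \<open>Divisibility by 4, not just by 2, makes \<open>x + y\<close> congruent to
  \<open>2 * y\<close>, hence to 2, modulo 4.\<close>

lemma multiplicity_square_diff:
  fixes x y :: int
  assumes xy: "4 dvd x - y" and y: "odd y" and neq: "x \<noteq> y"
  shows "multiplicity 2 (x ^ 2 - y ^ 2) = Suc (multiplicity 2 (x - y))"
proof -
  have "x\<^sup>2 - y\<^sup>2 = (x - y) * (x + y)"
    by (simp add: power2_eq_square algebra_simps)
  moreover have "2 dvd x + y" "\<not> 4 dvd x + y"
    using xy y by presburger+
  ultimately show ?thesis
    using neq by (simp only:) (intro multiplicity_times_exact, auto)
qed

lemma multiplicity_int_eq:
  fixes p :: nat and z :: int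
  shows "multiplicity (int p) z = multiplicity p (nat \<bar>z\<bar>)"
proof -
  have "int p ^ n dvd z \<longleftrightarrow> p ^ n dvd nat \<bar>z\<bar>" for n
    by (simp flip: of_nat_power)
  then show ?thesis
    by (simp add: multiplicity_def)
qed

section \<open>Divisibility properties of the primitive index\<close>

locale coprime_powers =
  fixes k h :: nat
  assumes pos: "k > 0" "h > 0" and neq: "k \<noteq> h" and gcd_eq_1: "gcd k h = 1"
begin

abbreviation D :: "nat \<Rightarrow> int" where
  "D n \<equiv> int k ^ n - int h ^ n"

abbreviation P :: "nat \<Rightarrow> nat" where
  "P p \<equiv> primitive_index p k h"

abbreviation v :: "nat \<Rightarrow> nat \<Rightarrow> nat" where
  "v p n \<equiv> multiplicity (int p) (D n)"

lemma D_nonzero: "n > 0 \<Longrightarrow> D n \<noteq> 0"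
  using neq power_eq_iff_eq_base[of n "int k" "int h"] by simp

lemma index_props:
  assumes "n > 0" "int p dvd D n"
  shows index_pos: "P p > 0" and index_dvd: "int p dvd D (P p)"
proof -
  have ex: "\<exists>u>0. int p dvd D u"
    using assms by blast
  then have "P p = (LEAST u. u > 0 \<and> int p dvd D u)"
    by (simp add: primitive_index_def)
  then show "P p > 0" "int p dvd D (P p)"
    using LeastI_ex[OF ex] by simp_all
qed

text \<open>A positive index is not the default value 0, so some exponent exists and the least one
  is attained.\<close>

lemma index_dvd_D: "P p > 0 \<Longrightarrow> int p dvd D (P p)"
  using index_dvd[of _ p] by (metis primitive_index_def less_irrefl)

lemma index_le: "n > 0 \<Longrightarrow> int p dvd D n \<Longrightarrow> P p \<le> n"
  unfolding primitive_index_def by (auto intro: Least_le)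

text \<open>If \<open>p\<close> divided one of \<open>k\<close> and \<open>h\<close>, it would
  divide the other as well, against coprimality.\<close>

lemma not_dvd_of_dvd_D:
  assumes "prime p" "n > 0" "int p dvd D n"
  shows "\<not> p dvd h" "\<not> p dvd k"
proof -
  have "p dvd h \<longleftrightarrow> p dvd k"
  proof -
    have "int p dvd int h ^ n \<longleftrightarrow> int p dvd int k ^ n"
      using dvd_diff[OF _ assms(3), of "int k ^ n"] dvd_add[OF assms(3), of "int h ^ n"] by auto
    then show ?thesis
      using assms by (simp add: prime_dvd_power_iff)
  qed
  then show "\<not> p dvd h" "\<not> p dvd k"
    using gcd_eq_1 assms(1) by (metis gcd_greatest not_prime_unit)+
qed

lemma index_not_dvd:
  assumes "prime p" "P p > 0"
  shows "\<not> int p dvd int h" "\<not> int p dvd int k"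
  using not_dvd_of_dvd_D[OF assms index_dvd_D[OF assms(2)]] by auto

lemma not_dvd_power:
  assumes "prime p" "P p > 0"
  shows "\<not> int p dvd int h ^ m"
proof -
  have "prime (int p)"
    using assms(1) by simp
  then show ?thesis
    using index_not_dvd(1)[OF assms] prime_dvd_power by blast
qed

lemma D_dvd: "D m dvd D (m * c)"
  using power_diff_eq_sum[of "int k ^ m" c "int h ^ m"] by (simp add: power_mult)

lemma dvd_D_iff:
  assumes p: "prime p" and u: "P p > 0"
  shows "int p dvd D n \<longleftrightarrow> P p dvd n"
proof
  assume "P p dvd n"
  then show "int p dvd D n"
    using dvd_trans[OF index_dvd_D[OF u] D_dvd] by (elim dvdE) (simp del: of_nat_power)
next
  assume n: "int p dvd D n"
  \<comment> \<open>Division with remainder: \<open>p\<close> divides \<open>D ?q\<close>, so it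
    must divide \<open>D ?r\<close>, and minimality of the index leaves only
    \<open>?r = 0\<close>.\<close>
  let ?q = "P p * (n div P p)" and ?r = "n mod P p"
  have "D n = int k ^ (?q + ?r) - int h ^ (?q + ?r)"
    by simp
  also have "\<dots> = int k ^ ?r * D ?q + int h ^ ?q * D ?r"
    unfolding power_add by (simp add: algebra_simps)
  finally have "int p dvd int h ^ ?q * D ?r"
    using n dvd_mult[OF dvd_trans[OF index_dvd_D[OF u] D_dvd[of "P p" "n div P p"]], of "int k ^ ?r"]
    by (simp only: dvd_add_right_iff)
  then have "int p dvd D ?r"
    using p not_dvd_power[OF p u, of ?q] prime_dvd_mult_iff[of "int p" "int h ^ ?q"] by simp
  then have "?r = 0"
    using index_le[of ?r p] u mod_less_divisor[OF u, of n] by linarith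
  then show "P p dvd n" by auto
qed

lemma index_dvd_pred:
  assumes p: "prime p" and u: "P p > 0"
  shows "P p dvd p - 1"
proof -
  have "[k ^ (p - 1) = 1] (mod p)" "[h ^ (p - 1) = 1] (mod p)"
    using p index_not_dvd[OF p u] by (intro fermat_theorem; simp)+
  then have "[int k ^ (p - 1) = int h ^ (p - 1)] (mod int p)"
    by (metis cong_int_iff cong_sym cong_trans of_nat_power)
  then show ?thesis
    using dvd_D_iff[OF p u] by (simp add: cong_iff_dvd_diff)
qed

lemma index_less:
  assumes "prime p" "P p > 0"
  shows "P p < p"
  using index_dvd_pred[OF assms] prime_gt_1_nat[OF assms(1)] dvd_imp_le[of "P p" "p - 1"] by linarith

lemma not_dvd_index:
  assumes "prime p" "P p > 0"
  shows "\<not> p dvd P p"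
  using index_less[OF assms] assms(2) by (auto dest: dvd_imp_le)

text \<open>Since \<open>P p < p\<close>, the prime \<open>p\<close> is the largest prime factor of \<open>p ^ z * P p\<close>.\<close>

lemma index_prime_unique:
  assumes p: "prime p" "z > 0" "n = p ^ z * P p" and q: "prime q" "w > 0" "n = q ^ w * P q"
    and n: "n > 0"
  shows "p = q"
proof -
  have "a \<le> b" if a: "prime a" "x > 0" "n = a ^ x * P a" and b: "prime b" "n = b ^ y * P b"
    for a b x y
  proof -
    have "a dvd b ^ y * P b"
      using a b by (metis dvd_mult2 dvd_power)
    then have "a dvd b \<or> a dvd P b"
      using a(1) by (auto simp: prime_dvd_mult_iff dest: prime_dvd_power)
    moreover have "P b > 0"
      using b n by (cases "P b") auto
    ultimately show "a \<le> b"
      using index_less[OF b(1)] prime_gt_0_nat[OF b(1)] by (auto dest!: dvd_imp_le)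
  qed
  from this[OF p q(1,3)] this[OF q p(1,3)] show ?thesis by simp
qed

section \<open>Valuations along multiples of the index and their Moebius inverse\<close>

lemma v_coprime_mult:
  assumes p: "prime p" and u: "P p > 0" and m: "P p dvd m" and c: "\<not> p dvd c"
  shows "v p (m * c) = v p m"
proof -
  have "\<not> int p dvd int h ^ m"
    by (rule not_dvd_power[OF p u])
  then show ?thesis
    using multiplicity_power_diff_coprime[of "int p" "int k ^ m" "int h ^ m" c]
      p c dvd_D_iff[OF p u] m by (simp add: power_mult)
qed

lemma v_mult_prime:
  assumes p: "prime p" and u: "P p > 0" and m: "P p dvd m" "m > 0" and "p = 2 \<Longrightarrow> even m"
  shows "v p (m * p) = Suc (v p m)"
proof -
  have h: "\<not> int p dvd int h ^ m"
    by (rule not_dvd_power[OF p u])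
  have neq': "int k ^ m \<noteq> int h ^ m"
    using D_nonzero[OF m(2)] by simp
  show ?thesis
  proof (cases "p = 2")
    case False
    then show ?thesis
      using multiplicity_power_diff_odd_prime[OF p False _ h neq'] dvd_D_iff[OF p u] m
      by (simp add: power_mult)
  next
    case True
    \<comment> \<open>For \<open>p = 2\<close> the index only yields that \<open>D m\<close> is
      even. Factoring it as a difference of squares gives the divisibility by 4 that lifting
      requires.\<close>
    then obtain j where j: "m = 2 * j"
      using assms(5) by (auto elim: evenE)
    have "odd (int k)" "odd (int h)"
      using index_not_dvd[OF p u] True by auto
    then have "even (int k ^ j - int h ^ j)" "even (int k ^ j + int h ^ j)"
      by simp_all
    then have "2 * 2 dvd (int k ^ j - int h ^ j) * (int k ^ j + int h ^ j)"
      by (rule mult_dvd_mono)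
    also have "\<dots> = int k ^ m - int h ^ m"
      by (simp only: j mult_2 power_add) (simp add: algebra_simps)
    finally have "4 dvd int k ^ m - int h ^ m"
      by simp
    then show ?thesis
      using multiplicity_square_diff[OF _ _ neq'] True h by (simp add: power_mult)
  qed
qed

text \<open>The \<open>p\<close>-adic valuation of the cyclotomic value, chosen so that its sum over the divisors
  of \<open>n\<close> telescopes to \<open>v p n\<close>.\<close>

definition cyc_val :: "nat \<Rightarrow> nat \<Rightarrow> nat" where
  "cyc_val p n =
     (if n = P p then v p n
      else if \<exists>z>0. n = p ^ z * P p then v p n - v p (n div p) else 0)"

text \<open>Both nontrivial cases of \<open>cyc_val\<close> make \<open>n\<close> a multiple of
  \<open>P p\<close>; if \<open>P p = 0\<close> they would force \<open>n = 0\<close>.\<close>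

lemma cyc_val_eq_0:
  assumes "prime p" "n > 0" "\<not> int p dvd D n"
  shows "cyc_val p n = 0"
proof -
  have "\<not> P p dvd n" if "P p > 0"
    using dvd_D_iff[OF assms(1) that] assms(3) by simp
  then show ?thesis
    using assms(2) by (cases "P p = 0") (auto simp: cyc_val_def)
qed

lemma sum_cyc_val:
  assumes p: "prime p" and n: "n > 0"
  shows "(\<Sum>d | d dvd n. cyc_val p d) = v p n"
proof (cases "int p dvd D n")
  case False
  then have "\<not> int p dvd D d" if "d dvd n" for d
    using that dvd_trans[OF _ D_dvd, of "int p" d] by (elim dvdE) auto
  then have "(\<Sum>d | d dvd n. cyc_val p d) = 0"
    using cyc_val_eq_0[OF p] n by (intro sum.neutral) (auto intro: dvd_pos_nat)
  then show ?thesis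
    using False by (simp add: not_dvd_imp_multiplicity_0)
next
  case True
  then have u: "P p > 0"
    using index_pos n by blast
  have pu: "\<not> p dvd P p"
    by (rule not_dvd_index[OF p u])
  obtain c0 where c0: "n = P p * c0"
    using True dvd_D_iff[OF p u] by (auto elim: dvdE)
  with n have "c0 \<noteq> 0" by auto
  \<comment> \<open>Of the divisors of \<open>n = P p * p ^ m * c\<close>, only those of the form
    \<open>P p * p ^ i\<close> with \<open>i \<le> m\<close> contribute.\<close>
  then obtain c m where c: "c0 = p ^ m * c" "\<not> p dvd c"
    using multiplicity_decompose'[of c0 p] p not_prime_unit by metis
  have nm: "n = P p * p ^ m * c"
    using c0 c by simp
  have p1: "p > 1"
    using p by (rule prime_gt_1_nat)
  let ?e = "\<lambda>i. P p * p ^ i"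
  have inj: "inj_on ?e {..m}"
    using u p1 by (auto simp: inj_on_def power_inject_exp)
  have "(\<Sum>d | d dvd n. cyc_val p d) = (\<Sum>d\<in>?e ` {..m}. cyc_val p d)"
  proof (rule sum.mono_neutral_right)
    show "finite {d. d dvd n}"
      using n by simp
    show "?e ` {..m} \<subseteq> {d. d dvd n}"
      unfolding nm by (intro image_subsetI CollectI dvd_mult2 mult_dvd_mono dvd_refl le_imp_power_dvd) simp
    show "\<forall>d\<in>{d. d dvd n} - ?e ` {..m}. cyc_val p d = 0"
    proof
      fix d assume d: "d \<in> {d. d dvd n} - ?e ` {..m}"
      have "False" if "d = p ^ z * P p" for z
      proof -
        have "p ^ z dvd p ^ m * c"
          using d that u unfolding nm by (auto simp: mult_ac)
        then have "p ^ z dvd p ^ m"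
          using c(2) p by (metis coprime_dvd_mult_left_iff coprime_power_left_iff prime_imp_coprime
            coprime_commute)
        then have "z \<le> m"
          using p1 by (simp add: dvd_power_iff_le)
        then show False
          using d that by (auto simp: mult.commute)
      qed
      \<comment> \<open>The instance \<open>z = 0\<close> excludes the first case of
        \<open>cyc_val\<close>, namely \<open>d = P p\<close>.\<close>
      from this this[of 0] show "cyc_val p d = 0"
        by (auto simp: cyc_val_def)
    qed
  qed
  also have "\<dots> = (\<Sum>i\<le>m. cyc_val p (?e i))"
    by (rule sum.reindex_cong[OF inj]) auto
  also have "\<dots> = v p (?e m)"
  proof (induction m)
    case 0
    show ?case by (simp add: cyc_val_def)
  next
    case (Suc m)
    \<comment> \<open>Monotonicity is needed for telescoping, since the subtraction in
      \<open>cyc_val\<close> is truncated.\<close>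
    have "v p (?e m) \<le> v p (?e (Suc m))"
      using D_dvd[of "?e m" p] D_nonzero[of "?e (Suc m)"] u p1
      by (intro dvd_imp_multiplicity_le) (auto simp: mult_ac)
    moreover have "cyc_val p (?e (Suc m)) = v p (?e (Suc m)) - v p (?e m)"
    proof -
      have "?e (Suc m) \<noteq> P p"
        using u p1 one_less_power[of p "Suc m"] by auto
      moreover have "\<exists>z>0. ?e (Suc m) = p ^ z * P p"
        by (intro exI[of _ "Suc m"]) simp
      moreover have "?e (Suc m) div p = ?e m"
        using p1 by simp
      ultimately show ?thesis
        by (simp add: cyc_val_def)
    qed
    ultimately show ?case
      using Suc.IH by simp
  qed
  also have "\<dots> = v p n"
    unfolding nm by (rule v_coprime_mult[OF p u _ c(2), symmetric]) simp
  finally show ?thesis .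
qed

lemma cyc_val_eq_1:
  assumes p: "prime p" and z: "z > 0" "n = p ^ z * P p" and n: "n > 0" "n \<noteq> 2"
  shows "cyc_val p n = 1"
proof -
  have u: "P p > 0"
    using z n by (cases "P p") auto
  have p1: "p > 1"
    using p by (rule prime_gt_1_nat)
  obtain y where y: "z = Suc y"
    using z by (cases z) auto
  define m where "m = P p * p ^ y"
  have nm: "n = m * p"
    using z y by (simp add: m_def mult_ac)
  \<comment> \<open>Here the index is 1, so \<open>n\<close> is a power of 2, and
    \<open>n \<noteq> 2\<close> keeps \<open>m = n div 2\<close> even.\<close>
  have "even m" if "p = 2"
  proof -
    have "P p = 1"
      using index_less[OF p u] u that by simp
    then have "y \<noteq> 0"
      using n nm that by (auto simp: m_def)
    then show ?thesis
      using that by (simp add: m_def)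
  qed
  then have "v p n = Suc (v p m)"
    unfolding nm using u p1 by (intro v_mult_prime[OF p u]) (auto simp: m_def)
  moreover have "n div p = m"
    using nm p1 by simp
  moreover have "n \<noteq> P p"
    using not_dvd_index[OF p u] nm by (metis dvd_triv_right)
  ultimately show ?thesis
    using z by (auto simp: cyc_val_def)
qed

section \<open>Reassembling the cyclotomic value from its valuations\<close>

definition primes_of :: "nat \<Rightarrow> nat set" where
  "primes_of n = {p. prime p \<and> int p dvd D n}"

text \<open>This is the absolute value of the cyclotomic value, an integer by construction;
  \<open>hom_cyclotomic_eq\<close> makes the identification.\<close>

definition cyc_abs :: "nat \<Rightarrow> nat" where
  "cyc_abs n = (\<Prod>p\<in>primes_of n. p ^ cyc_val p n)"

lemma finite_primes_of:
  assumes "n > 0"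
  shows "finite (primes_of n)"
proof -
  have "finite {p. p dvd nat \<bar>D n\<bar>}"
    using D_nonzero[OF assms] by (intro finite_divisors_nat) simp
  then show ?thesis
    by (rule rev_finite_subset) (auto simp: primes_of_def dvd_nat_abs_iff)
qed

lemma cyc_abs_pos: "cyc_abs n > 0"
  unfolding cyc_abs_def by (intro prod_pos) (auto simp: primes_of_def prime_gt_0_nat)

lemma multiplicity_cyc_abs:
  assumes "prime p" "n > 0"
  shows "multiplicity p (cyc_abs n) = cyc_val p n"
  unfolding cyc_abs_def
  using multiplicity_prod_prime_powers[OF finite_primes_of[OF assms(2)] _ assms(1)]
    cyc_val_eq_0[OF assms] assms(1) by (auto simp: primes_of_def)

lemma prod_cyc_abs:
  assumes n: "n > 0"
  shows "(\<Prod>d | d dvd n. cyc_abs d) = nat \<bar>D n\<bar>"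
proof (rule multiplicity_eq_nat)
  show "nat \<bar>D n\<bar> > 0"
    using D_nonzero[OF n] by simp
  show "(\<Prod>d | d dvd n. cyc_abs d) > 0"
    by (intro prod_pos cyc_abs_pos)
  fix p :: nat assume p: "prime p"
  have "0 \<notin> cyc_abs ` {d. d dvd n}"
    using cyc_abs_pos by (metis imageE less_irrefl)
  then have "multiplicity p (\<Prod>d | d dvd n. cyc_abs d) = (\<Sum>d | d dvd n. multiplicity p (cyc_abs d))"
    using p n by (intro prime_elem_multiplicity_prod_distrib) auto
  also have "\<dots> = (\<Sum>d | d dvd n. cyc_val p d)"
    using p n by (intro sum.cong refl multiplicity_cyc_abs) (auto intro: dvd_pos_nat)
  also have "\<dots> = multiplicity p (nat \<bar>D n\<bar>)"
    using sum_cyc_val[OF p n] by (simp add: multiplicity_int_eq)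
  finally show "multiplicity p (\<Prod>d | d dvd n. cyc_abs d) = multiplicity p (nat \<bar>D n\<bar>)" .
qed

text \<open>By \<open>prod_cyc_abs\<close>, the right-hand side satisfies, up to sign, the recursion
  that defines \<open>hom_cyclotomic\<close>.\<close>

lemma hom_cyclotomic_eq:
  "n > 0 \<Longrightarrow> hom_cyclotomic n k h = (if n = 1 \<and> k < h then - 1 else 1) * of_nat (cyc_abs n)"
proof (induction n rule: less_induct)
  case (less n)
  define s :: "nat \<Rightarrow> rat" where "s d = (if d = 1 \<and> k < h then - 1 else 1)" for d
  define Q where "Q = (\<Prod>d | d dvd n \<and> d < n. s d * of_nat (cyc_abs d))"
  have split: "{d. d dvd n} = insert n {d. d dvd n \<and> d < n}"
    using less.prems by (auto dest: dvd_imp_le)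
  have "s n * of_nat (cyc_abs n) * Q = (\<Prod>d | d dvd n. s d * of_nat (cyc_abs d))"
    using less.prems unfolding split Q_def by (subst prod.insert) auto
  also have "\<dots> = (\<Prod>d | d dvd n. s d) * of_nat (nat \<bar>D n\<bar>)"
    using prod_cyc_abs[OF less.prems] by (simp add: prod.distrib flip: of_nat_prod)
  \<comment> \<open>The divisor 1 alone carries the sign of \<open>D n\<close>, which is that of
    \<open>k - h\<close>.\<close>
  also have "(\<Prod>d | d dvd n. s d) = (\<Prod>d\<in>{1}. s d)"
    using less.prems by (intro prod.mono_neutral_right) (auto simp: s_def)
  also have "\<dots> * of_nat (nat \<bar>D n\<bar>) = of_int (D n)"
  proof (cases "k < h")
    case True
    then have "k ^ n < h ^ n"
      using less.prems by (intro power_strict_mono) auto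
    then have "D n < 0"
      by (metis of_nat_less_iff of_nat_power diff_less_0_iff_less)
    then show ?thesis using True by (simp add: s_def of_nat_nat)
  next
    case False
    then have "h ^ n \<le> k ^ n"
      by (intro power_mono) auto
    then have "D n \<ge> 0"
      by (metis of_nat_le_iff of_nat_power diff_ge_0_iff_ge)
    then show ?thesis using False by (simp add: s_def of_nat_nat)
  qed
  finally have eq: "s n * of_nat (cyc_abs n) * Q = of_int (D n)" .
  have "hom_cyclotomic n k h = of_int (D n) / (\<Prod>d | d dvd n \<and> d < n. hom_cyclotomic d k h)"
    by (subst hom_cyclotomic.simps) simp
  also have "(\<Prod>d | d dvd n \<and> d < n. hom_cyclotomic d k h) = Q"
    unfolding Q_def s_def using less by (intro prod.cong) (auto intro: dvd_pos_nat)
  also have "of_int (D n) / Q = s n * of_nat (cyc_abs n)"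
  proof -
    have "Q \<noteq> 0"
      using eq D_nonzero[OF less.prems] by (metis mult_zero_right of_int_eq_0_iff)
    then show ?thesis unfolding eq[symmetric] by simp
  qed
  finally show ?case by (simp add: s_def)
qed

section \<open>Comparison with the Zsigmondy number\<close>

text \<open>For primes of index \<open>n\<close>, \<open>cyc_val p n\<close> is the full valuation
  \<open>v p n\<close>, so the Zsigmondy number is a subproduct of \<open>cyc_abs n\<close>.\<close>

lemma zsigmondy_number_eq:
  assumes "n > 0"
  shows "zsigmondy_number n k h = (\<Prod>p\<in>{p \<in> primes_of n. P p = n}. p ^ cyc_val p n)"
  unfolding zsigmondy_number_def
  by (intro prod.cong) (auto simp: primitive_prime_divisor_def primes_of_def cyc_val_def)

lemma cyc_abs_eq_zsigmondy:
  assumes n: "n > 0" and none: "\<And>p z. prime p \<Longrightarrow> z > 0 \<Longrightarrow> n \<noteq> p ^ z * P p"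
  shows "cyc_abs n = zsigmondy_number n k h"
  unfolding zsigmondy_number_eq[OF n] cyc_abs_def
  using none finite_primes_of[OF n]
  by (intro prod.mono_neutral_right) (auto simp: cyc_val_def primes_of_def)

text \<open>By \<open>index_prime_unique\<close>, \<open>p\<close> is the only prime outside the
  Zsigmondy number with a nonzero exponent, and that exponent is 1 by
  \<open>cyc_val_eq_1\<close>.\<close>

lemma cyc_abs_eq_prime_times_zsigmondy:
  assumes p: "prime p" "z > 0" "n = p ^ z * P p" and n: "n > 0" "n \<noteq> 2"
  shows "cyc_abs n = p * zsigmondy_number n k h"
proof -
  have fin: "finite (primes_of n)"
    by (rule finite_primes_of[OF n(1)])
  have u: "P p > 0"
    using p n by (cases "P p") auto
  have "p \<in> primes_of n"
    using p dvd_D_iff[OF p(1) u, of n] by (auto simp: primes_of_def)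
  moreover have "P p \<noteq> n"
    using p not_dvd_index[OF p(1) u] by (metis dvd_mult2 dvd_power)
  moreover have "cyc_val q n = 0" if "prime q" "q \<noteq> p" "P q \<noteq> n" for q
    using that index_prime_unique[OF p _ _ _ n(1)] by (auto simp: cyc_val_def)
  ultimately have "cyc_abs n = (\<Prod>q\<in>insert p {q \<in> primes_of n. P q = n}. q ^ cyc_val q n)"
    unfolding cyc_abs_def using fin
    by (intro prod.mono_neutral_right) (auto simp: primes_of_def)
  then show ?thesis
    using \<open>P p \<noteq> n\<close> fin cyc_val_eq_1[OF p n] by (simp add: zsigmondy_number_eq[OF n(1)])
qed

end

text \<open>The Zsigmondy number is positive, but at \<open>n = 1\<close> with \<open>k < h\<close>
  the cyclotomic value is \<open>k - h < 0\<close>; hence the sign in the first case. In the second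
  case \<open>p\<close> divides \<open>n\<close>, so \<open>n \<noteq> 1\<close> and no sign
  occurs.\<close>

theorem theorem10:
  fixes k h n :: nat
  assumes "k > 0" and "h > 0" and "k \<noteq> h" and "gcd k h = 1"
    and "n > 0" and "n \<noteq> 2"
  shows "((\<forall>p z. prime p \<and> z > 0 \<longrightarrow> n \<noteq> p ^ z * primitive_index p k h) \<longrightarrow>
            of_nat (zsigmondy_number n k h) =
              (if n = 1 \<and> k < h then - hom_cyclotomic n k h else hom_cyclotomic n k h)) \<and>
         (\<forall>p z. prime p \<and> z > 0 \<and> n = p ^ z * primitive_index p k h \<longrightarrow>
            of_nat (zsigmondy_number n k h) = hom_cyclotomic n k h / of_nat p)"
proof -
  interpret coprime_powers k h
    using assms by unfold_locales
  have "of_nat (zsigmondy_number n k h) =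
      (if n = 1 \<and> k < h then - hom_cyclotomic n k h else hom_cyclotomic n k h)"
    if "\<forall>p z. prime p \<and> z > 0 \<longrightarrow> n \<noteq> p ^ z * P p"
    using that cyc_abs_eq_zsigmondy[OF \<open>n > 0\<close>] hom_cyclotomic_eq[OF \<open>n > 0\<close>] by auto
  moreover have "of_nat (zsigmondy_number n k h) = hom_cyclotomic n k h / of_nat p"
    if p: "prime p" "z > 0" "n = p ^ z * P p" for p z
  proof -
    have "p dvd n"
      using p by (metis dvd_mult2 dvd_power)
    then have "n \<noteq> 1"
      using p by auto
    then have "hom_cyclotomic n k h = of_nat p * of_nat (zsigmondy_number n k h)"
      using hom_cyclotomic_eq[OF \<open>n > 0\<close>] cyc_abs_eq_prime_times_zsigmondy[OF p] assms by simp
    then show ?thesis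
      using prime_gt_0_nat[OF p(1)] by simp
  qed
  ultimately show ?thesis by blast
qed

end
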